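(* For every $n\ge1$, the number of periodic patterns of length $n$ of the tent map $\Lambda=\Sigma_{+-}$, counted up to cyclic rotation, is $$p_n(\Lambda)=\frac{1}{2n}\sum_{\substack{d\mid n\\ d\text{ odd}}}\mu(d)\,2^{n/d},$$ where $\mu$ is the Möbius function.
   Context: For $\sigma\in\{+,-\}^k$ ($k\ge2$), let $\mathcal W_k$ be the set of infinite words over $\{0,\dots,k-1\}$ with the linear order $\prec_\sigma$: for $s\neq t$, with $j$ the first index where $s_j\neq t_j$ and $c=|\{i<j:\sigma_{s_i}=-\}|$, $s\prec_\sigma t$ iff ($c$ even and $s_j<t_j$) or ($c$ odd and $s_j>t_j$). The signed shift $\Sigma_\sigma$ deletes the first letter of a word. Let $\mathcal W_{k,n}$ be the set of words $(s_1\dots s_n)^\infty$ (infinite repetition) with $s_1\dots s_n$ primitive (not a power of a shorter word). For $s\in\mathcal W_{k,n}$ let $\Pi_\sigma(s)\in\mathcal S_n$ be the permutation with $\Pi_\sigma(s)_i<\Pi_\sigma(s)_j$ iff $s_is_{i+1}\dots\prec_\sigma s_js_{j+1}\dots$. Let $\mathcal P_n(\Sigma_\sigma)=\{\Pi_\sigma(s):s\in\mathcal W_{k,n}\}$; this set is closed under cyclic rotation of one-line notation, and $p_n(\Sigma_\sigma)=|\mathcal P_n(\Sigma_\sigma)|/n$ is the number of its classes under cyclic rotation. The tent map is $\Lambda=\Sigma_{+-}$ ($k=2$, $\sigma=+-$). *)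

theory Defs
  imports
    "HOL-Number_Theory.Number_Theory"
    "HOL-Combinatorics.Multiset_Permutations"
    "HOL-Computational_Algebra.Squarefree"
    "HOL-Library.Stream"
begin

datatype sign = Plus | Minus

text \<open>
  A sign vector \<open>\<sigma> \<in> {+,-}^k\<close> is a list of signs of length \<open>k\<close>; infinite words over the
  alphabet \<open>{0,\<dots>,k-1}\<close> are elements of \<open>streams {..<k}\<close>, with positions counted from \<open>0\<close>.
  The signed shift \<open>\<Sigma>\<^sub>\<sigma>\<close> is \<^const>\<open>stl\<close> on these words; \<open>\<sigma>\<close> enters only through the order.
\<close>

definition signed_less :: "sign list \<Rightarrow> nat stream \<Rightarrow> nat stream \<Rightarrow> bool" where
  "signed_less \<sigma> s t \<longleftrightarrow> s \<noteq> t \<and>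
    (let j = (LEAST j. s !! j \<noteq> t !! j);
         c = card {i. i < j \<and> \<sigma> ! (s !! i) = Minus}
     in (even c \<and> s !! j < t !! j) \<or> (odd c \<and> s !! j > t !! j))"

definition primitive_word :: "'a list \<Rightarrow> bool" where
  "primitive_word w \<longleftrightarrow> \<not> (\<exists>u m. length u < length w \<and> w = concat (replicate m u))"

definition periodic_words :: "nat \<Rightarrow> nat \<Rightarrow> nat stream set" where
  "periodic_words k n =
    {cycle w | w. length w = n \<and> set w \<subseteq> {..<k} \<and> primitive_word w}"

text \<open>Permutations in \<open>S\<^sub>n\<close> are given in one-line notation, as lists with entries \<open>{1..n}\<close>.\<close>

definition is_pattern :: "sign list \<Rightarrow> nat \<Rightarrow> nat stream \<Rightarrow> nat list \<Rightarrow> bool" where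
  "is_pattern \<sigma> n s \<pi> \<longleftrightarrow> \<pi> \<in> permutations_of_set {1..n} \<and>
    (\<forall>i<n. \<forall>j<n. \<pi> ! i < \<pi> ! j \<longleftrightarrow> signed_less \<sigma> (sdrop i s) (sdrop j s))"

definition pattern :: "sign list \<Rightarrow> nat \<Rightarrow> nat stream \<Rightarrow> nat list" where
  "pattern \<sigma> n s = (THE \<pi>. is_pattern \<sigma> n s \<pi>)"

definition periodic_patterns :: "sign list \<Rightarrow> nat \<Rightarrow> nat list set" where
  "periodic_patterns \<sigma> n = pattern \<sigma> n ` periodic_words (length \<sigma>) n"

definition rotation_rel :: "'a list set \<Rightarrow> 'a list rel" where
  "rotation_rel A = {(\<pi>, \<rho>). \<pi> \<in> A \<and> \<rho> \<in> A \<and> (\<exists>m. \<rho> = rotate m \<pi>)}"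

text \<open>
  The number of rotation classes; it equals \<open>card (periodic_patterns \<sigma> n) / n\<close> by the lemma
  \<open>num_pattern_classes_eq\<close> below.
\<close>

definition num_pattern_classes :: "sign list \<Rightarrow> nat \<Rightarrow> nat" where
  "num_pattern_classes \<sigma> n =
    card (periodic_patterns \<sigma> n // rotation_rel (periodic_patterns \<sigma> n))"

definition tent :: "sign list" where
  "tent = [Plus, Minus]"

definition moebius_mu :: "nat \<Rightarrow> int" where
  "moebius_mu n = (if squarefree n then (- 1) ^ card (prime_factors n) else 0)"


lemma signed_lessI:
  assumes "\<forall>i<j. s !! i = t !! i"
    and "(even (card {i. i < j \<and> \<sigma> ! (s !! i) = Minus}) \<and> s !! j < t !! j) \<or>
         (odd (card {i. i < j \<and> \<sigma> ! (s !! i) = Minus}) \<and> s !! j > t !! j)"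
  shows "signed_less \<sigma> s t"
proof -
  have ne: "s !! j \<noteq> t !! j" using assms(2) by auto
  have L: "(LEAST j. s !! j \<noteq> t !! j) = j"
    using ne assms(1) by (metis (mono_tags, lifting) Least_equality linorder_not_le)
  show ?thesis unfolding signed_less_def L Let_def using ne assms(2) by auto
qed

lemma signed_lessE:
  assumes "signed_less \<sigma> s t"
  obtains j where "\<forall>i<j. s !! i = t !! i"
    and "(even (card {i. i < j \<and> \<sigma> ! (s !! i) = Minus}) \<and> s !! j < t !! j) \<or>
         (odd (card {i. i < j \<and> \<sigma> ! (s !! i) = Minus}) \<and> s !! j > t !! j)"
proof (rule that)
  show "\<forall>i<(LEAST j. s !! j \<noteq> t !! j). s !! i = t !! i"
    using not_less_Least by blast
qed (use assms in \<open>simp add: signed_less_def Let_def\<close>)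

lemma signed_less_irrefl: "\<not> signed_less \<sigma> s s"
  by (simp add: signed_less_def)

lemma signed_less_total:
  assumes "s \<noteq> t"
  shows "signed_less \<sigma> s t \<or> signed_less \<sigma> t s"
proof -
  obtain j where "s !! j \<noteq> t !! j"
    using assms smap_alt[of id s t] by (auto simp: stream.map_id)
  define j where "j = (LEAST j. s !! j \<noteq> t !! j)"
  have ne: "s !! j \<noteq> t !! j" unfolding j_def by (rule LeastI) fact
  have eq: "\<forall>i<j. s !! i = t !! i" unfolding j_def using not_less_Least by blast
  have c: "{i. i < j \<and> \<sigma> ! (s !! i) = Minus} = {i. i < j \<and> \<sigma> ! (t !! i) = Minus}"
    using eq by auto
  show ?thesis
    using signed_lessI[of j s t \<sigma>] signed_lessI[of j t s \<sigma>] eq ne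
    unfolding c by (metis nat_neq_iff)
qed

lemma signed_less_trans:
  assumes "signed_less \<sigma> s t" "signed_less \<sigma> t u"
  shows "signed_less \<sigma> s u"
proof -
  obtain j where j: "\<forall>i<j. s !! i = t !! i"
    "(even (card {i. i < j \<and> \<sigma> ! (s !! i) = Minus}) \<and> s !! j < t !! j) \<or>
     (odd (card {i. i < j \<and> \<sigma> ! (s !! i) = Minus}) \<and> s !! j > t !! j)"
    using signed_lessE[OF assms(1)] by blast
  obtain l where l: "\<forall>i<l. t !! i = u !! i"
    "(even (card {i. i < l \<and> \<sigma> ! (t !! i) = Minus}) \<and> t !! l < u !! l) \<or>
     (odd (card {i. i < l \<and> \<sigma> ! (t !! i) = Minus}) \<and> t !! l > u !! l)"
    using signed_lessE[OF assms(2)] by blast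
  consider "j < l" | "l < j" | "j = l" by linarith
  then show ?thesis
  proof cases
    case 1
    show ?thesis by (rule signed_lessI[of j]) (use 1 j l in auto)
  next
    case 2
    have c: "{i. i < l \<and> \<sigma> ! (t !! i) = Minus} = {i. i < l \<and> \<sigma> ! (s !! i) = Minus}"
      using 2 j(1) by auto
    show ?thesis by (rule signed_lessI[of l]) (use 2 j(1) l[unfolded c] in auto)
  next
    case 3
    have c: "{i. i < l \<and> \<sigma> ! (t !! i) = Minus} = {i. i < l \<and> \<sigma> ! (s !! i) = Minus}"
      using 3 j(1) by auto
    show ?thesis by (rule signed_lessI[of l]) (use 3 j l[unfolded c] in auto)
  qed
qed

lemma primitive_rotate:
  assumes "primitive_word w" "rotate p w = w" "p < length w"
  shows "p = 0"
proof (rule ccontr)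
  assume "p \<noteq> 0"
  have "drop p w @ take p w = take p w @ drop p w"
    using assms(2,3) by (simp add: rotate_drop_take)
  then obtain a b zs where z: "concat (replicate a zs) = drop p w"
    "concat (replicate b zs) = take p w"
    using comm_append_are_replicate by metis
  have "a > 0" "b > 0" "zs \<noteq> []"
    using z \<open>p \<noteq> 0\<close> assms(3) by (auto intro!: Nat.gr0I)
  have w: "w = concat (replicate (b + a) zs)"
    by (simp add: replicate_add z)
  have "length w = (b + a) * length zs"
    by (subst w) (simp add: length_concat sum_list_replicate)
  also have "\<dots> > length zs"
    using \<open>a > 0\<close> \<open>b > 0\<close> \<open>zs \<noteq> []\<close> by (cases a; cases b) auto
  finally show False
    using assms(1) w unfolding primitive_word_def by blast
qed

lemma sdrop_periodic_inj:
  assumes "s \<in> periodic_words k n" "i < n" "j < n" "sdrop i s = sdrop j s"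
  shows "i = j"
proof -
  have *: "i = j" if le: "i \<le> j" and lt: "j < n" and eq: "sdrop i s = sdrop j s" for i j
  proof -
    obtain w where w: "s = cycle w" "length w = n" "primitive_word w"
      using assms(1) by (auto simp: periodic_words_def)
    have ne: "w \<noteq> []" using w lt by auto
    have "cycle (rotate i w) = cycle (rotate j w)"
      using eq le lt w ne by (simp add: sdrop_cycle)
    then have "stake n (cycle (rotate i w)) = stake n (cycle (rotate j w))" by simp
    then have "rotate i w = rotate j w"
      using stake_cycle_eq[of "rotate i w"] stake_cycle_eq[of "rotate j w"] ne w(2) by simp
    also have "\<dots> = rotate i (rotate (j - i) w)"
      using le by (simp add: rotate_rotate)
    finally have "rotate (j - i) w = w"
      using inj_fn[OF inj_rotate1, of i] unfolding rotate_def by (metis injD)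
    then have "j - i = 0"
      using primitive_rotate[of w "j - i"] w lt by simp
    then show ?thesis using le by simp
  qed
  show ?thesis
    using *[of i j] *[of j i] assms by (metis nat_le_linear)
qed

lemma nth_permutation_eq_card:
  assumes "\<pi> \<in> permutations_of_set {1..n}" "i < n"
  shows "\<pi> ! i = Suc (card {j. j < n \<and> \<pi> ! j < \<pi> ! i})"
proof -
  have len: "length \<pi> = n" and d: "distinct \<pi>" and set: "set \<pi> = {1..n}"
    using assms(1) length_finite_permutations_of_set[OF assms(1)]
    by (auto dest: permutations_of_setD)
  have r: "\<pi> ! i \<in> {1..n}" using set assms(2) len nth_mem by blast
  have "(!) \<pi> ` {j. j < n \<and> \<pi> ! j < \<pi> ! i} = {x \<in> set \<pi>. x < \<pi> ! i}"
    using len by (auto simp: in_set_conv_nth)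
  also have "\<dots> = {1..<\<pi> ! i}" using set r by auto
  finally have "card ((!) \<pi> ` {j. j < n \<and> \<pi> ! j < \<pi> ! i}) = \<pi> ! i - 1" by simp
  moreover have "inj_on ((!) \<pi>) {j. j < n \<and> \<pi> ! j < \<pi> ! i}"
    using d len by (auto simp: inj_on_def nth_eq_iff_index_eq)
  ultimately show ?thesis using r by (simp add: card_image)
qed

lemma is_pattern_unique:
  assumes "is_pattern \<sigma> n s \<pi>" "is_pattern \<sigma> n s \<rho>"
  shows "\<pi> = \<rho>"
proof (rule nth_equalityI)
  have p: "\<pi> \<in> permutations_of_set {1..n}" and r: "\<rho> \<in> permutations_of_set {1..n}"
    using assms by (auto simp: is_pattern_def)
  show "length \<pi> = length \<rho>"
    using p r length_finite_permutations_of_set by metis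
  fix i assume "i < length \<pi>"
  then have i: "i < n" using length_finite_permutations_of_set[OF p] by simp
  have "{j. j < n \<and> \<pi> ! j < \<pi> ! i} = {j. j < n \<and> \<rho> ! j < \<rho> ! i}"
    using assms i by (auto simp: is_pattern_def)
  then show "\<pi> ! i = \<rho> ! i"
    using nth_permutation_eq_card[OF p i] nth_permutation_eq_card[OF r i] by simp
qed

lemma is_pattern_exists:
  assumes "s \<in> periodic_words k n"
  shows "\<exists>\<pi>. is_pattern \<sigma> n s \<pi>"
proof -
  define r where "r i j = signed_less \<sigma> (sdrop i s) (sdrop j s)" for i j
  define f where "f i = Suc (card {j. j < n \<and> r j i})" for i
  have mono: "f i < f j" if "r i j" "i < n" "j < n" for i j
  proof -
    have "{l. l < n \<and> r l i} \<subset> {l. l < n \<and> r l j}"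
      using that signed_less_trans signed_less_irrefl unfolding r_def by blast
    then show ?thesis unfolding f_def by (simp add: psubset_card_mono)
  qed
  have tot: "r i j \<or> r j i" if "i < n" "j < n" "i \<noteq> j" for i j
    using that sdrop_periodic_inj[OF assms] signed_less_total unfolding r_def by blast
  have iff: "f i < f j \<longleftrightarrow> r i j" if "i < n" "j < n" for i j
    using that mono[of i j] mono[of j i] tot[of i j] by fastforce
  have inj: "inj_on f {..<n}"
    using tot mono unfolding inj_on_def by (metis lessThan_iff less_irrefl)
  have "f ` {..<n} \<subseteq> {1..n}"
  proof
    fix x assume "x \<in> f ` {..<n}"
    then obtain i where i: "i < n" "x = f i" by auto
    have "{j. j < n \<and> r j i} \<subset> {..<n}"
      using i signed_less_irrefl unfolding r_def by blast
    then have "card {j. j < n \<and> r j i} < n"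
      using psubset_card_mono[OF finite_lessThan] by (metis card_lessThan)
    then show "x \<in> {1..n}" using i by (simp add: f_def)
  qed
  then have "f ` {..<n} = {1..n}"
    using inj by (intro card_subset_eq) (auto simp: card_image)
  then have "map f [0..<n] \<in> permutations_of_set {1..n}"
    using inj by (auto simp: permutations_of_set_def distinct_map atLeast0LessThan)
  then have "is_pattern \<sigma> n s (map f [0..<n])"
    using iff by (simp add: is_pattern_def r_def)
  then show ?thesis by blast
qed

lemma pattern_eqI: "is_pattern \<sigma> n s \<pi> \<Longrightarrow> pattern \<sigma> n s = \<pi>"
  unfolding pattern_def using is_pattern_unique by blast

lemma is_pattern_pattern:
  "s \<in> periodic_words k n \<Longrightarrow> is_pattern \<sigma> n s (pattern \<sigma> n s)"
  using is_pattern_exists pattern_eqI by metis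

lemma periodic_patterns_permutations:
  "periodic_patterns \<sigma> n \<subseteq> permutations_of_set {1..n}"
  using is_pattern_pattern by (auto simp: periodic_patterns_def is_pattern_def)

lemma sdrop_mod_periodic:
  assumes "s \<in> periodic_words k n" "n > 0"
  shows "sdrop (i mod n) s = sdrop i s"
proof -
  obtain w where "s = cycle w" "length w = n" using assms(1) by (auto simp: periodic_words_def)
  then show ?thesis using assms(2) by (metis sdrop_cycle length_greater_0_conv mod_mod_trivial)
qed

lemma primitive_word_rotate1:
  assumes "primitive_word w"
  shows "primitive_word (rotate1 w)"
proof (rule ccontr)
  assume "\<not> primitive_word (rotate1 w)"
  then obtain u m where u: "length u < length w" "rotate1 w = concat (replicate m u)"
    by (auto simp: primitive_word_def)
  have ne: "w \<noteq> []" using u by auto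
  have comm: "rotate (length u) (rotate1 w) = rotate1 w"
  proof (cases m)
    case 0
    then show ?thesis using u by simp
  next
    case (Suc l)
    have "concat (replicate l u) @ u = u @ concat (replicate l u)"
      by (induction l) auto
    then show ?thesis using u Suc by (simp add: rotate_append)
  qed
  then have "rotate1 (rotate (length u) w) = rotate1 w"
    by (simp add: rotate1_rotate_swap)
  then have "rotate (length u) w = w"
    using inj_rotate1 by (metis injD)
  then have "length u = 0"
    using primitive_rotate[OF assms] u(1) by blast
  then have "rotate1 w = []" using u(2) by simp
  then show False using ne by simp
qed

lemma stl_periodic_words:
  assumes "s \<in> periodic_words k n" "n > 0"
  shows "stl s \<in> periodic_words k n"
proof -
  obtain w where w: "s = cycle w" "length w = n" "set w \<subseteq> {..<k}" "primitive_word w"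
    using assms(1) by (auto simp: periodic_words_def)
  have "stl s = cycle (rotate1 w)"
    using w assms(2) by (cases w) auto
  then show ?thesis
    using w primitive_word_rotate1 unfolding periodic_words_def
    by (metis (mono_tags, lifting) length_rotate1 mem_Collect_eq set_rotate1)
qed

lemma pattern_stl:
  assumes "s \<in> periodic_words k n" "n > 0"
  shows "pattern \<sigma> n (stl s) = rotate1 (pattern \<sigma> n s)"
proof (rule pattern_eqI)
  have p: "is_pattern \<sigma> n s (pattern \<sigma> n s)" using is_pattern_pattern assms by blast
  then have len: "length (pattern \<sigma> n s) = n"
    using length_finite_permutations_of_set by (fastforce simp: is_pattern_def)
  have *: "sdrop i (stl s) = sdrop (Suc i mod n) s" for i
    using sdrop_mod_periodic[OF assms, of "Suc i"] by simp
  show "is_pattern \<sigma> n (stl s) (rotate1 (pattern \<sigma> n s))"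
    using p len assms(2) unfolding is_pattern_def *
    by (auto simp: permutations_of_set_def nth_rotate1)
qed

lemma rotate_periodic_patterns:
  assumes "\<pi> \<in> periodic_patterns \<sigma> n" "n > 0"
  shows "rotate m \<pi> \<in> periodic_patterns \<sigma> n"
proof (induction m)
  case (Suc m)
  then obtain s where "s \<in> periodic_words (length \<sigma>) n" "rotate m \<pi> = pattern \<sigma> n s"
    by (auto simp: periodic_patterns_def)
  then have "rotate (Suc m) \<pi> = pattern \<sigma> n (stl s)" "stl s \<in> periodic_words (length \<sigma>) n"
    using pattern_stl stl_periodic_words assms(2) by auto
  then show ?case by (simp add: periodic_patterns_def)
qed (use assms in simp)

lemma num_pattern_classes_eq:
  assumes "n > 0"
  shows "real (num_pattern_classes \<sigma> n) = real (card (periodic_patterns \<sigma> n)) / real n"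
proof -
  define P where "P = periodic_patterns \<sigma> n"
  define R where "R = rotation_rel P"
  have len: "length \<pi> = n" and dist: "distinct \<pi>" if "\<pi> \<in> P" for \<pi>
    using that periodic_patterns_permutations[of \<sigma> n]
      length_finite_permutations_of_set[of \<pi> "{1..n}"]
    by (auto simp: P_def permutations_of_set_def)
  have fin: "finite P"
    unfolding P_def using periodic_patterns_permutations
    by (rule finite_subset) (rule finite_permutations_of_set)
  have eqv: "equiv P R"
  proof (rule equivI)
    show "R \<subseteq> P \<times> P" by (auto simp: R_def rotation_rel_def)
    show "refl_on P R"
      by (auto simp: R_def rotation_rel_def refl_on_def intro!: exI[of _ 0])
    show "sym R"
    proof (rule symI)
      fix x y assume "(x, y) \<in> R"
      then obtain m where m: "x \<in> P" "y \<in> P" "y = rotate m x"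
        by (auto simp: R_def rotation_rel_def)
      have "m + (n * m - m) = n * m" using assms by (cases n) auto
      then have "rotate (n * m - m) y = rotate (n * m) x"
        using m(3) by (simp add: rotate_rotate add.commute)
      also have "\<dots> = x" using len[OF m(1)] by (metis mod_mult_self1_is_0 rotate_id)
      finally show "(y, x) \<in> R" using m(1,2) unfolding R_def rotation_rel_def
        by (metis (mono_tags, lifting) case_prodI mem_Collect_eq)
    qed
    show "trans R"
      by (rule transI) (auto simp: R_def rotation_rel_def rotate_rotate)
  qed
  have cls: "card c = n" if c: "c \<in> P // R" for c
  proof -
    obtain \<pi> where p: "\<pi> \<in> P" "c = R `` {\<pi>}" using c by (auto elim: quotientE)
    have "c = (\<lambda>m. rotate m \<pi>) ` {..<n}"
    proof (intro equalityI subsetI)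
      fix x assume "x \<in> c"
      then obtain m where "x = rotate m \<pi>" using p by (auto simp: R_def rotation_rel_def)
      then have "x = rotate (m mod n) \<pi>" using len[OF p(1)] by (metis rotate_conv_mod)
      then show "x \<in> (\<lambda>m. rotate m \<pi>) ` {..<n}" using assms by auto
    next
      fix x assume "x \<in> (\<lambda>m. rotate m \<pi>) ` {..<n}"
      then show "x \<in> c"
        using p rotate_periodic_patterns[OF _ assms] by (auto simp: R_def rotation_rel_def P_def)
    qed
    moreover have "inj_on (\<lambda>m. rotate m \<pi>) {..<n}"
    proof (rule inj_onI)
      fix a b assume ab: "a \<in> {..<n}" "b \<in> {..<n}" "rotate a \<pi> = rotate b \<pi>"
      have "rotate a \<pi> ! 0 = \<pi> ! a" "rotate b \<pi> ! 0 = \<pi> ! b"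
        using ab(1,2) assms len[OF p(1)] by (simp_all add: nth_rotate)
      then have "\<pi> ! a = \<pi> ! b" using ab(3) by simp
      then show "a = b"
        using ab dist[OF p(1)] len[OF p(1)] by (simp add: nth_eq_iff_index_eq)
    qed
    ultimately show ?thesis by (simp add: card_image)
  qed
  have "n * card (P // R) = card (\<Union>(P // R))"
  proof (rule card_partition)
    show "finite (P // R)" using fin eqv by (simp add: equiv_def finite_quotient)
    show "finite (\<Union>(P // R))" using fin Union_quotient[OF eqv] by simp
    show "card c = n" if "c \<in> P // R" for c using cls[OF that] .
    show "c \<inter> d = {}" if "c \<in> P // R" "d \<in> P // R" "c \<noteq> d" for c d
      using quotient_disj[OF eqv that(1,2)] that(3) by blast
  qed
  then have "n * card (P // R) = card P" using Union_quotient[OF eqv] by simp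
  then have "real n * real (card (P // R)) = real (card P)" by (metis of_nat_mult)
  then show ?thesis
    using assms by (simp add: num_pattern_classes_def P_def R_def field_simps)
qed

end

theory Submission
  imports Defs
begin

text \<open>
  Each periodic pattern of the tent map is realized by exactly one primitive word of odd weight
  (number of ones). On ranks, the shift acts by a unimodal cyclic permutation, increasing on the
  shifts starting with 0 and decreasing on those starting with 1. So the pattern determines every
  letter except the one at the position whose successor has the largest rank; there both letters
  respect the pattern, and exactly one of them makes the weight odd. Odd weight makes the word
  primitive: if two distinct shifts agreed, transporting their ranks once around the cycle would
  reverse their order. Since an odd-weight word can only be an odd power, Moebius inversion over
  the odd divisors counts the primitive ones among the \<open>2 ^ (n - 1)\<close> words of odd weight.
\<close>

section \<open>Moebius sums\<close>

lemma moebius_mu_prime_mult: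
  assumes "prime p" "\<not> p dvd e"
  shows "moebius_mu (p * e) = - moebius_mu e"
proof -
  have cop: "coprime p e" using assms by (rule prime_imp_coprime)
  have e0: "e \<noteq> 0" using assms(2) by (metis dvd_0_right)
  have "squarefree (p * e) \<longleftrightarrow> squarefree e"
    using cop squarefree_mult_coprime squarefree_multD(2) squarefree_prime[OF assms(1)] by blast
  moreover have "prime_factors (p * e) = insert p (prime_factors e)"
    using assms(1) e0 by (simp add: prime_factorization_mult prime_factorization_prime)
  moreover have "p \<notin> prime_factors e" using assms(2) by auto
  ultimately show ?thesis by (simp add: moebius_mu_def)
qed

text \<open>For a prime \<open>p\<close> dividing \<open>n\<close>, the divisors prime to
  \<open>p\<close> cancel against their multiples by \<open>p\<close>. Every other divisor is
  divisible by the square of \<open>p\<close> and contributes 0.\<close>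

lemma sum_moebius_mu_divisors:
  assumes "n > 0"
  shows "(\<Sum>d | d dvd n. moebius_mu d) = (if n = 1 then 1 else 0)"
proof (cases "n = 1")
  case True
  then show ?thesis by (simp add: moebius_mu_def)
next
  case False
  then obtain p where p: "prime p" "p dvd n" using prime_factor_nat by blast
  let ?A = "{d. d dvd n \<and> \<not> p dvd d}"
  let ?B = "(\<lambda>e. p * e) ` ?A"
  have fin: "finite {d. d dvd n}" using assms by simp
  then have finA: "finite ?A" by (rule rev_finite_subset) auto
  have "(\<Sum>d | d dvd n. moebius_mu d) = (\<Sum>d\<in>?A \<union> ?B. moebius_mu d)"
  proof (rule sum.mono_neutral_right[OF fin])
    have "p * e dvd n" if "e \<in> ?A" for e
      using that p(2) prime_imp_coprime[OF p(1), of e] by (simp add: divides_mult)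
    then show "?A \<union> ?B \<subseteq> {d. d dvd n}" by blast
    show "\<forall>d\<in>{d. d dvd n} - (?A \<union> ?B). moebius_mu d = 0"
    proof
      fix d assume d: "d \<in> {d. d dvd n} - (?A \<union> ?B)"
      then have "p dvd d" by blast
      then obtain e where e: "d = p * e" by (rule dvdE)
      then have "e dvd n" using d dvd_mult_right[of p e n] by simp
      then have "p dvd e" using d e by auto
      then have "p\<^sup>2 dvd d" using e by (simp add: power2_eq_square)
      then have "\<not> squarefree d" using p(1) not_prime_unit unfolding squarefree_def by blast
      then show "moebius_mu d = 0" by (simp add: moebius_mu_def)
    qed
  qed
  also have "\<dots> = (\<Sum>d\<in>?A. moebius_mu d) + (\<Sum>d\<in>?B. moebius_mu d)"
    using finA by (intro sum.union_disjoint) auto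
  also have "(\<Sum>d\<in>?B. moebius_mu d) = (\<Sum>e\<in>?A. moebius_mu (p * e))"
    using p(1) by (subst sum.reindex) (auto simp: inj_on_def prime_gt_0_nat)
  also have "\<dots> = (\<Sum>e\<in>?A. - moebius_mu e)"
    using p(1) by (intro sum.cong refl moebius_mu_prime_mult) auto
  finally show ?thesis using False by (simp add: sum_negf)
qed

section \<open>Counting primitive words of odd weight\<close>

lemma rotate_concat_replicate:
  "rotate (length u) (concat (replicate d u)) = concat (replicate d u)"
proof (cases d)
  case (Suc l)
  have "concat (replicate l u) @ u = u @ concat (replicate l u)"
    by (induction l) auto
  then show ?thesis using Suc by (simp add: rotate_append)
qed simp

text \<open>Turns primitivity into a condition on the rotations that fix \<open>w\<close>, the form
  in which Moebius inversion can detect it.\<close>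

lemma primitive_word_iff_rotate:
  assumes "w \<noteq> []"
  shows "primitive_word w \<longleftrightarrow> (\<forall>p. 0 < p \<and> p < length w \<longrightarrow> rotate p w \<noteq> w)"
proof
  assume "primitive_word w"
  then show "\<forall>p. 0 < p \<and> p < length w \<longrightarrow> rotate p w \<noteq> w"
    using primitive_rotate by blast
next
  assume rot: "\<forall>p. 0 < p \<and> p < length w \<longrightarrow> rotate p w \<noteq> w"
  show "primitive_word w"
  proof (rule ccontr)
    assume "\<not> primitive_word w"
    then obtain u m where u: "length u < length w" "w = concat (replicate m u)"
      by (auto simp: primitive_word_def)
    then have "rotate (length u) w = w" using rotate_concat_replicate by blast
    moreover have "u \<noteq> []" using u(2) assms by auto
    ultimately show False using rot u(1) by auto
  qed
qed

text \<open>The least positive rotation fixing \<open>w\<close> generates all others: the remainder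
  of any fixing rotation modulo it also fixes \<open>w\<close>, so by minimality it is 0.\<close>

lemma ex_rotation_period:
  fixes w :: "'a list"
  assumes "w \<noteq> []"
  shows "\<exists>p>0. \<forall>m. rotate m w = w \<longleftrightarrow> p dvd m"
proof -
  define p where "p = (LEAST p. p > 0 \<and> rotate p w = w)"
  have "length w > 0 \<and> rotate (length w) w = w" using assms by simp
  then have p: "p > 0" "rotate p w = w" unfolding p_def by (metis (mono_tags, lifting) LeastI)+
  have mult: "rotate (p * k) w = w" for k
    by (induction k) (use p(2) in \<open>simp, metis mult_Suc_right rotate_rotate\<close>)
  have "rotate m w = w \<longleftrightarrow> p dvd m" for m
  proof
    assume m: "rotate m w = w"
    have "rotate (m mod p) (rotate (p * (m div p)) w) = rotate m w"
      by (simp only: rotate_rotate mod_mult_div_eq)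
    then have "rotate (m mod p) w = w" using m mult by simp
    then have "\<not> m mod p > 0"
      using not_less_Least[of "m mod p" "\<lambda>p. p > 0 \<and> rotate p w = w"] p(1)
      unfolding p_def[symmetric] by auto
    then show "p dvd m" by auto
  qed (use mult in auto)
  then show ?thesis using p(1) by blast
qed

text \<open>The letters are 0 and 1, so \<open>sum_list\<close> counts the ones, which are the
  order-reversing letters of the tent map.\<close>

definition odd_words :: "nat \<Rightarrow> nat list set" where
  "odd_words n = {w. length w = n \<and> set w \<subseteq> {..<2} \<and> odd (sum_list w)}"

lemma finite_odd_words: "finite (odd_words n)"
  by (rule finite_subset[OF _ finite_lists_length_eq[of "{..<2::nat}" n]]) (auto simp: odd_words_def)

text \<open>All letters but the first are free; the parity then forces the first.\<close>

lemma card_odd_words: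
  assumes "n > 0"
  shows "card (odd_words n) = 2 ^ (n - 1)"
proof -
  obtain m where m: "n = Suc m" using assms by (cases n) auto
  have "bij_betw (\<lambda>w. (if odd (sum_list w) then 0 else 1) # w)
      {w. set w \<subseteq> {..<2::nat} \<and> length w = m} (odd_words n)"
  proof (rule bij_betwI[where g = tl])
    show "tl \<in> odd_words n \<rightarrow> {w. set w \<subseteq> {..<2::nat} \<and> length w = m}"
      by (auto simp: odd_words_def m length_Suc_conv)
    fix w assume "w \<in> odd_words n"
    then show "(if odd (sum_list (tl w)) then 0 else 1) # tl w = w"
      by (cases w) (auto simp: odd_words_def m less_2_cases_iff)
  qed (auto simp: odd_words_def m)
  then have "card (odd_words n) = card {w. set w \<subseteq> {..<2::nat} \<and> length w = m}"
    by (rule bij_betw_same_card[symmetric])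
  then show ?thesis by (simp add: card_lists_length_eq m)
qed

lemma length_concat_replicate: "length (concat (replicate d u)) = d * length u"
  by (induction d) auto

lemma sum_list_concat_replicate:
  "sum_list (concat (replicate d u)) = d * sum_list (u :: nat list)"
  by (induction d) auto

text \<open>Invariance under rotation by \<open>m\<close> makes the letter at \<open>i\<close>
  depend only on \<open>i mod m\<close>, because stepping back by \<open>m\<close> does not change
  it.\<close>

lemma rotate_fixed_imp_power:
  assumes "length w = d * m" "rotate m w = w"
  shows "w = concat (replicate d (take m w))"
proof (cases "d = 0 \<or> m = 0")
  case False
  define n where "n = d * m"
  have n: "n > 0" "length w = n" using False assms(1) by (auto simp: n_def)
  have step: "w ! ((i + m) mod n) = w ! i" if "i < n" for i
    using nth_rotate[of i w m] that n assms(2) by (simp add: add.commute)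
  have nth: "w ! i = w ! (i mod m)" if "i < n" for i
    using that
  proof (induction i rule: less_induct)
    case (less i)
    show ?case
    proof (cases "i < m")
      case False
      then have "w ! (i - m) = w ! ((i - m) mod m)"
        using less.IH[of "i - m"] less.prems \<open>\<not> (d = 0 \<or> m = 0)\<close> by linarith
      moreover have "w ! (i - m) = w ! i" using step[of "i - m"] less.prems False by simp
      ultimately show ?thesis using False by (simp add: le_mod_geq[of m i])
    qed simp
  qed
  have len: "length (take m w) = m" using False assms(1) by (cases d) auto
  have nth_power: "concat (replicate k u) ! i = u ! (i mod length u)"
    if "i < k * length u" for k i and u :: "'a list"
    using that
  proof (induction k arbitrary: i)
    case (Suc k)
    show ?case
    proof (cases "i < length u")
      case False
      then show ?thesis
        using Suc.IH[of "i - length u"] Suc.prems by (simp add: nth_append le_mod_geq[of "length u" i])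
    qed (simp add: nth_append)
  qed simp
  show ?thesis
  proof (rule nth_equalityI)
    show "length w = length (concat (replicate d (take m w)))"
      using len assms(1) by (simp only: length_concat_replicate)
    show "w ! i = concat (replicate d (take m w)) ! i" if "i < length w" for i
    proof -
      have "concat (replicate d (take m w)) ! i = take m w ! (i mod m)"
        using nth_power[of i d "take m w"] that len assms(1) by simp
      then show ?thesis using nth[of i] that n False by simp
    qed
  qed
qed (use assms in auto)

text \<open>The fixed words are the \<open>d\<close>-th powers of words of length
  \<open>n div d\<close>. Taking the power multiplies the weight by \<open>d\<close>, so odd weight
  forces \<open>d\<close> to be odd, and then it holds for the power exactly when it holds for the
  root.\<close>

lemma card_odd_words_rotate_fixed:
  assumes "n > 0" "d dvd n"
  shows "card {w \<in> odd_words n. rotate (n div d) w = w} = (if odd d then 2 ^ (n div d - 1) else 0)"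
proof -
  define m where "m = n div d"
  have n: "n = d * m" using assms(2) by (simp add: m_def)
  then have pos: "m > 0" "d > 0" using assms(1) by auto
  let ?F = "{w \<in> odd_words n. rotate m w = w}"
  have pow: "w = concat (replicate d (take m w))" "length (take m w) = m" if "w \<in> ?F" for w
    using that rotate_fixed_imp_power[of w d m] n pos(2) by (simp_all add: odd_words_def)
  have sum: "sum_list w = d * sum_list (take m w)" if "w \<in> ?F" for w
    using pow(1)[OF that] sum_list_concat_replicate by metis
  show ?thesis
  proof (cases "odd d")
    case True
    have "bij_betw (\<lambda>u. concat (replicate d u)) (odd_words m) ?F"
    proof (rule bij_betwI[where g = "take m"])
      show "(\<lambda>u. concat (replicate d u)) \<in> odd_words m \<rightarrow> ?F"
      proof
        fix u assume u: "u \<in> odd_words m"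
        let ?w = "concat (replicate d u)"
        have "length ?w = n" "odd (sum_list ?w)" "rotate m ?w = ?w"
          using u True rotate_concat_replicate[of u d] length_concat_replicate[of d u] n
            sum_list_concat_replicate[of d u] by (simp_all only: odd_words_def mem_Collect_eq even_mult_iff simp_thms)
        moreover have "set ?w \<subseteq> {..<2}" using u by (auto simp: odd_words_def)
        ultimately show "?w \<in> ?F" unfolding odd_words_def by blast
      qed
      show "take m \<in> ?F \<rightarrow> odd_words m"
      proof
        fix w assume w: "w \<in> ?F"
        then have "odd (sum_list (take m w))" "set (take m w) \<subseteq> {..<2}"
          using sum[OF w] set_take_subset[of m w] by (auto simp: odd_words_def)
        then show "take m w \<in> odd_words m" using pow(2)[OF w] by (simp add: odd_words_def)
      qed
      show "take m (concat (replicate d u)) = u" if "u \<in> odd_words m" for u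
        using that pos(2) by (cases d) (auto simp: odd_words_def)
      show "concat (replicate d (take m w)) = w" if "w \<in> ?F" for w
        using pow(1)[OF that] by (rule sym)
    qed
    then have "card ?F = card (odd_words m)" by (rule bij_betw_same_card[symmetric])
    then show ?thesis using True pos(1) card_odd_words[of m] by (simp add: m_def)
  next
    case False
    have "w \<notin> ?F" for w
    proof
      assume w: "w \<in> ?F"
      then show False using sum[OF w] False by (simp add: odd_words_def)
    qed
    then have "?F = {}" by blast
    then have "card ?F = 0" by (simp only: card.empty)
    then show ?thesis using False by (simp add: m_def)
  qed
qed

text \<open>The indicator of primitivity is written as a Moebius sum over the rotations fixing the
  word. Exchanging the two sums leaves the counts of fixed words, which vanish for even
  \<open>d\<close>.\<close>

lemma card_primitive_odd_words:
  assumes "n > 0"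
  shows "2 * int (card {w \<in> odd_words n. primitive_word w}) =
    (\<Sum>d | d dvd n \<and> odd d. moebius_mu d * 2 ^ (n div d))"
proof -
  let ?D = "{d. d dvd n}"
  have finD: "finite ?D" using assms by simp
  \<comment> \<open>If \<open>p\<close> is the rotation period of \<open>w\<close> and
    \<open>n = p * q\<close>, rotation by \<open>n div d\<close> fixes \<open>w\<close> exactly when
    \<open>d\<close> divides \<open>q\<close>. The sum is therefore 1 if \<open>q = 1\<close>, that
    is, if the period is the full length, and 0 otherwise.\<close>
  have inner: "(\<Sum>d\<in>?D. if rotate (n div d) w = w then moebius_mu d else 0) =
      (if primitive_word w then 1 else 0)" if w: "w \<in> odd_words n" for w
  proof -
    have len: "length w = n" "w \<noteq> []" using w assms by (auto simp: odd_words_def)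
    obtain p where p: "p > 0" "\<And>m. rotate m w = w \<longleftrightarrow> p dvd m"
      using ex_rotation_period[OF len(2)] by blast
    have "p dvd n" using p(2)[of n] len by simp
    then obtain q where q: "n = p * q" by auto
    have q0: "q > 0" using q assms by (cases q) auto
    have "(\<Sum>d\<in>?D. if rotate (n div d) w = w then moebius_mu d else 0) =
        (\<Sum>d\<in>{d \<in> ?D. p dvd n div d}. moebius_mu d)"
      by (simp only: p(2) sum.inter_filter[OF finD])
    also have "{d \<in> ?D. p dvd n div d} = {d. d dvd q}"
    proof (intro equalityI subsetI)
      fix d assume "d \<in> {d \<in> ?D. p dvd n div d}"
      then have "d dvd n" "p dvd n div d" by auto
      obtain c where c: "n div d = p * c" using \<open>p dvd n div d\<close> by (rule dvdE)
      have "n = d * (n div d)" using \<open>d dvd n\<close> by simp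
      also have "\<dots> = p * (d * c)" unfolding c by (rule mult.left_commute)
      finally have "p * q = p * (d * c)" unfolding q .
      then show "d \<in> {d. d dvd q}" using p(1) by simp
    next
      fix d assume "d \<in> {d. d dvd q}"
      then obtain c where c: "q = d * c" by auto
      then have "n div d = p * c" using q q0 by (simp add: mult.left_commute)
      then show "d \<in> {d \<in> ?D. p dvd n div d}" using q c by simp
    qed
    also have "(\<Sum>d | d dvd q. moebius_mu d) = (if q = 1 then 1 else 0)"
      using sum_moebius_mu_divisors[OF q0] .
    also have "q = 1 \<longleftrightarrow> primitive_word w"
    proof -
      have "q = 1 \<longleftrightarrow> p = n" using q p(1) by simp (rule eq_commute)
      also have "\<dots> \<longleftrightarrow> primitive_word w"
      proof
        assume "p = n"
        then show "primitive_word w"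
          unfolding primitive_word_iff_rotate[OF len(2)] p(2) len(1) by (simp add: nat_dvd_not_less)
      next
        assume "primitive_word w"
        then have "\<not> (0 < p \<and> p < n)"
          unfolding primitive_word_iff_rotate[OF len(2)] p(2) len(1) using dvd_refl[of p] by metis
        then show "p = n" using dvd_imp_le[OF \<open>p dvd n\<close> assms] p(1) by simp
      qed
      finally show ?thesis .
    qed
    finally show ?thesis .
  qed
  have "int (card {w \<in> odd_words n. primitive_word w}) =
      (\<Sum>w\<in>odd_words n. if primitive_word w then 1 else 0)"
    by (simp add: sum.inter_filter[OF finite_odd_words, symmetric])
  also have "\<dots> = (\<Sum>w\<in>odd_words n. \<Sum>d\<in>?D. if rotate (n div d) w = w then moebius_mu d else 0)"
    by (intro sum.cong refl inner[symmetric])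
  also have "\<dots> = (\<Sum>d\<in>?D. \<Sum>w\<in>odd_words n. if rotate (n div d) w = w then moebius_mu d else 0)"
    by (rule sum.swap)
  also have "\<dots> = (\<Sum>d\<in>?D. moebius_mu d * int (card {w \<in> odd_words n. rotate (n div d) w = w}))"
    by (intro sum.cong refl) (simp add: sum.inter_filter[OF finite_odd_words, symmetric])
  also have "\<dots> = (\<Sum>d\<in>?D. if odd d then moebius_mu d * 2 ^ (n div d - 1) else 0)"
    using assms by (intro sum.cong refl) (simp add: card_odd_words_rotate_fixed)
  also have "\<dots> = (\<Sum>d | d dvd n \<and> odd d. moebius_mu d * 2 ^ (n div d - 1))"
    by (simp add: sum.inter_filter[OF finD, symmetric])
  finally have "2 * int (card {w \<in> odd_words n. primitive_word w}) =
      (\<Sum>d | d dvd n \<and> odd d. 2 * (moebius_mu d * 2 ^ (n div d - 1)))"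
    by (simp add: sum_distrib_left)
  also have "\<dots> = (\<Sum>d | d dvd n \<and> odd d. moebius_mu d * 2 ^ (n div d))"
  proof (intro sum.cong refl)
    fix d assume "d \<in> {d. d dvd n \<and> odd d}"
    \<comment> \<open>Subtraction is truncated in \<open>n div d - 1\<close>; positivity of
      \<open>n div d\<close> lets the factor 2 be absorbed into the power.\<close>
    then have "n div d > 0" using assms by auto
    then show "2 * (moebius_mu d * 2 ^ (n div d - 1)) = moebius_mu d * 2 ^ (n div d)"
      by (cases "n div d") auto
  qed
  finally show ?thesis .
qed

section \<open>Words compatible with a permutation\<close>

lemma signed_less_shd:
  assumes "shd s < shd t"
  shows "signed_less \<sigma> s t"
  by (rule signed_lessI[of 0]) (use assms in auto)

text \<open>Deleting a common first letter moves the first difference one place to the left. It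
  changes the parity of the number of preceding minus signs, and so reverses the comparison, exactly
  when that letter carries a minus.\<close>

lemma signed_less_step:
  assumes "shd s = shd t"
  shows "signed_less \<sigma> s t \<longleftrightarrow>
    (if \<sigma> ! shd s = Minus then signed_less \<sigma> (stl t) (stl s) else signed_less \<sigma> (stl s) (stl t))"
proof -
  have card: "card {i. i < Suc j \<and> \<sigma> ! (s !! i) = Minus} =
      (if \<sigma> ! shd s = Minus then Suc else id) (card {i. i < j \<and> \<sigma> ! (stl s !! i) = Minus})"
    for s :: "nat stream" and j
  proof -
    have "{i. i < Suc j \<and> \<sigma> ! (s !! i) = Minus} =
        (if \<sigma> ! shd s = Minus then {0} else {}) \<union> Suc ` {i. i < j \<and> \<sigma> ! (stl s !! i) = Minus}"
    proof (rule Set.set_eqI)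
      fix i
      show "i \<in> {i. i < Suc j \<and> \<sigma> ! (s !! i) = Minus} \<longleftrightarrow>
        i \<in> (if \<sigma> ! shd s = Minus then {0} else {}) \<union> Suc ` {i. i < j \<and> \<sigma> ! (stl s !! i) = Minus}"
        by (cases i) auto
    qed
    then show ?thesis by (simp add: card_image)
  qed
  \<comment> \<open>Only this direction is proved through the first difference; the converse follows
    from totality and asymmetry of the order.\<close>
  have imp: "signed_less \<sigma> s t"
    if "shd s = shd t"
      "if \<sigma> ! shd s = Minus then signed_less \<sigma> (stl t) (stl s) else signed_less \<sigma> (stl s) (stl t)"
    for s t
  proof (cases "\<sigma> ! shd s = Minus")
    case True
    then have "signed_less \<sigma> (stl t) (stl s)" using that(2) by simp
    then obtain j where j: "\<forall>i<j. stl t !! i = stl s !! i"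
      "(even (card {i. i < j \<and> \<sigma> ! (stl t !! i) = Minus}) \<and> stl t !! j < stl s !! j) \<or>
       (odd (card {i. i < j \<and> \<sigma> ! (stl t !! i) = Minus}) \<and> stl t !! j > stl s !! j)"
      by (rule signed_lessE)
    have c: "{i. i < j \<and> \<sigma> ! (stl t !! i) = Minus} = {i. i < j \<and> \<sigma> ! (stl s !! i) = Minus}"
      using j(1) by auto
    show ?thesis
    proof (rule signed_lessI[of "Suc j"])
      show "\<forall>i<Suc j. s !! i = t !! i"
        unfolding All_less_Suc2 using that(1) j(1) by simp
    qed (use j(2)[unfolded c] True in \<open>auto simp: card\<close>)
  next
    case False
    then have "signed_less \<sigma> (stl s) (stl t)" using that(2) by simp
    then obtain j where j: "\<forall>i<j. stl s !! i = stl t !! i"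
      "(even (card {i. i < j \<and> \<sigma> ! (stl s !! i) = Minus}) \<and> stl s !! j < stl t !! j) \<or>
       (odd (card {i. i < j \<and> \<sigma> ! (stl s !! i) = Minus}) \<and> stl s !! j > stl t !! j)"
      by (rule signed_lessE)
    show ?thesis
    proof (rule signed_lessI[of "Suc j"])
      show "\<forall>i<Suc j. s !! i = t !! i"
        unfolding All_less_Suc2 using that(1) j(1) by simp
    qed (use j(2) False in \<open>auto simp: card\<close>)
  qed
  have asym: "signed_less \<sigma> s t \<Longrightarrow> \<not> signed_less \<sigma> t s" for s t
    using signed_less_trans signed_less_irrefl by blast
  show ?thesis
  proof (cases "stl s = stl t")
    case True
    then have "s = t" using assms by (metis stream.collapse)
    then show ?thesis by (simp add: signed_less_irrefl)
  next
    case False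
    then consider "signed_less \<sigma> (stl s) (stl t)" | "signed_less \<sigma> (stl t) (stl s)"
      using signed_less_total by blast
    then show ?thesis
      by cases (use imp[of s t] imp[of t s] assms asym[of s t] asym[of t s]
        asym[of "stl s" "stl t"] asym[of "stl t" "stl s"] in \<open>simp_all split: if_splits\<close>)
  qed
qed

text \<open>On ranks the shift is increasing where \<open>w\<close> has letter 0, decreasing where it
  has letter 1, and all ranks with letter 0 precede those with letter 1.\<close>

definition compatible :: "nat \<Rightarrow> nat list \<Rightarrow> nat list \<Rightarrow> bool" where
  "compatible n \<pi> w \<longleftrightarrow> length w = n \<and> set w \<subseteq> {..<2} \<and>
    (\<forall>i<n. \<forall>j<n. \<pi> ! i < \<pi> ! j \<longrightarrow> w ! i \<le> w ! j \<and>
      (w ! i = w ! j \<longrightarrow>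
        (if w ! i = 0 then \<pi> ! (Suc i mod n) < \<pi> ! (Suc j mod n)
         else \<pi> ! (Suc j mod n) < \<pi> ! (Suc i mod n))))"

lemma compatible_letter_less:
  assumes "compatible n \<pi> w" "i < n"
  shows "w ! i < 2"
proof -
  have "w ! i \<in> {..<2}" using assms nth_mem[of i w] unfolding compatible_def by blast
  then show ?thesis by simp
qed

lemma snth_cycle:
  assumes "w \<noteq> []"
  shows "cycle w !! i = w ! (i mod length w)"
proof -
  have "cycle w !! i = shd (cycle (rotate (i mod length w) w))"
    using sdrop_cycle[OF assms, of i] sdrop_simps(1)[of i "cycle w"] by simp
  also have "\<dots> = hd (rotate (i mod length w) w)"
    by (rule cycle.simps(1))
  also have "\<dots> = w ! (i mod length w)"
    using assms by (simp add: hd_rotate_conv_nth)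
  finally show ?thesis .
qed

text \<open>The condition on letters is the comparison of first letters, and the condition on
  successors is \<open>signed_less_step\<close>, both read off the ranks of the shifts.\<close>

lemma compatible_pattern:
  assumes "n > 0" "length w = n" "set w \<subseteq> {..<2}" "primitive_word w"
  shows "compatible n (pattern tent n (cycle w)) w"
  unfolding compatible_def
proof (intro conjI allI impI)
  define s where "s = cycle w"
  define \<pi> where "\<pi> = pattern tent n s"
  have s: "s \<in> periodic_words 2 n" using assms by (auto simp: periodic_words_def s_def)
  have iff: "\<pi> ! i < \<pi> ! j \<longleftrightarrow> signed_less tent (sdrop i s) (sdrop j s)"
    if "i < n" "j < n" for i j
    using is_pattern_pattern[OF s] that unfolding \<pi>_def is_pattern_def by blast
  have nth: "s !! i = w ! i" if "i < n" for i
    using assms(1,2) that snth_cycle[of w i] by (cases w) (simp_all add: s_def)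
  fix i j assume i: "i < n" and j: "j < n"
    and lt: "pattern tent n (cycle w) ! i < pattern tent n (cycle w) ! j"
  have less: "signed_less tent (sdrop i s) (sdrop j s)"
    using iff[OF i j] lt by (simp add: s_def \<pi>_def)
  have shd: "shd (sdrop i s) = w ! i" "shd (sdrop j s) = w ! j"
    using nth i j by simp_all
  show "w ! i \<le> w ! j"
  proof (rule ccontr)
    assume "\<not> w ! i \<le> w ! j"
    then have "signed_less tent (sdrop j s) (sdrop i s)"
      using shd by (intro signed_less_shd) simp
    then show False using less signed_less_trans signed_less_irrefl by blast
  qed
  \<comment> \<open>Wrapping the index modulo \<open>n\<close> agrees with deleting a letter because
    the word repeats with period \<open>n\<close>.\<close>
  have nxt: "\<pi> ! (Suc i mod n) < \<pi> ! (Suc j mod n) \<longleftrightarrow>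
      signed_less tent (stl (sdrop i s)) (stl (sdrop j s))" for i j
    using iff[of "Suc i mod n" "Suc j mod n"] assms(1) sdrop_mod_periodic[OF s assms(1)]
    by simp
  assume eq: "w ! i = w ! j"
  have "w ! i \<in> {..<2}" using assms i nth_mem by blast
  then have "w ! i = 0 \<or> w ! i = 1" by auto
  then show "if w ! i = 0
      then pattern tent n (cycle w) ! (Suc i mod n) < pattern tent n (cycle w) ! (Suc j mod n)
      else pattern tent n (cycle w) ! (Suc j mod n) < pattern tent n (cycle w) ! (Suc i mod n)"
    unfolding s_def[symmetric] \<pi>_def[symmetric] nxt
    using less[unfolded signed_less_step[of "sdrop i s" "sdrop j s" tent, unfolded shd, OF eq]]
    by (auto simp: tent_def)
qed (use assms in auto)

text \<open>Compatibility says that the ranks obey the same one-letter recursion as the signed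
  order, so they agree with it as soon as the shifts differ somewhere. Odd weight guarantees such a
  difference, which yields primitivity as well.\<close>

lemma compatible_odd_imp:
  assumes "n > 0" "\<pi> \<in> permutations_of_set {1..n}" "compatible n \<pi> w" "odd (sum_list w)"
  shows "primitive_word w" and "pattern tent n (cycle w) = \<pi>"
proof -
  define s where "s = cycle w"
  \<comment> \<open>\<open>P\<close> extends the ranks periodically, so positions can advance around
    the cycle without wrapping.\<close>
  define P where "P i = \<pi> ! (i mod n)" for i
  have len: "length w = n" "w \<noteq> []"
    using assms by (auto simp: compatible_def)
  have nth: "s !! i = w ! (i mod n)" for i using len by (simp add: s_def snth_cycle)
  have two: "s !! i = 0 \<or> s !! i = 1" for i
    using nth[of i] compatible_letter_less[OF assms(3), of "i mod n"] assms(1)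
    by (simp add: less_2_cases_iff)
  have step: "s !! i \<le> s !! j \<and> (s !! i = s !! j \<longrightarrow>
      (if s !! i = 0 then P (Suc i) < P (Suc j) else P (Suc j) < P (Suc i)))"
    if "P i < P j" for i j
    using that assms(1,3) nth unfolding compatible_def P_def
    by (metis (no_types, lifting) mod_Suc_eq mod_less_divisor)
  \<comment> \<open>If two shifts agreed, going once around the cycle would reverse their ranks, since
    the weight is odd.\<close>
  have ne: "sdrop i s \<noteq> sdrop j s" if "P i < P j" for i j
  proof
    assume eq: "sdrop i s = sdrop j s"
    have eqn: "s !! (i + k) = s !! (j + k)" for k using eq by (metis sdrop_snth)
    \<comment> \<open>Each common letter 1 swaps the two ranks and each common letter 0 keeps them
      in order, so the parity of the ones passed records the current order.\<close>
    have inv: "if even (\<Sum>l<k. s !! (i + l)) then P (i + k) < P (j + k) else P (j + k) < P (i + k)" for k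
    proof (induction k)
      case (Suc k)
      then show ?case
        using step[of "i + k" "j + k"] step[of "j + k" "i + k"] eqn[of k] two[of "i + k"]
        by (auto split: if_splits)
    qed (use that in simp)
    have "(\<Sum>l<n. s !! (i + l)) = sum_list (rotate i w)"
      using len nth by (simp add: sum_list_sum_nth nth_rotate atLeast0LessThan)
    also have "\<dots> = sum_list (take (i mod n) w @ drop (i mod n) w)"
      unfolding rotate_drop_take len(1) sum_list_append by (rule add.commute)
    also have "\<dots> = sum_list w" by simp
    finally have "P (j + n) < P (i + n)" using inv[of n] assms(4) by simp
    then show False using that by (simp add: P_def)
  qed
  have len\<pi>: "length \<pi> = n" and dist: "distinct \<pi>"
    using assms(2) length_finite_permutations_of_set[OF assms(2)]
    by (auto dest: permutations_of_setD)
  \<comment> \<open>Here \<open>k\<close> is any differing offset, not necessarily the first: equal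
    first letters lower it by one, and unequal ones settle the comparison at once. The induction
    keeps \<open>i\<close> and \<open>j\<close> arbitrary because a letter 1 exchanges their
    roles.\<close>
  have less: "signed_less tent (sdrop i s) (sdrop j s)"
    if "P i < P j" "s !! (i + k) \<noteq> s !! (j + k)" for i j k
    using that
  proof (induction k arbitrary: i j)
    case 0
    then show ?case using step[of i j] signed_less_shd by simp
  next
    case (Suc k)
    show ?case
    proof (cases "s !! i = s !! j")
      case True
      have "if s !! i = 0 then signed_less tent (sdrop (Suc i) s) (sdrop (Suc j) s)
          else signed_less tent (sdrop (Suc j) s) (sdrop (Suc i) s)"
        using step[OF Suc.prems(1)] True Suc.IH[of "Suc i" "Suc j"] Suc.IH[of "Suc j" "Suc i"]
          Suc.prems(2) by auto
      then show ?thesis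
        using signed_less_step[of "sdrop i s" "sdrop j s" tent] True two[of i]
        by (auto simp: tent_def split: if_splits)
    next
      case False
      then show ?thesis using step[OF Suc.prems(1)] signed_less_shd by simp
    qed
  qed
  have mono: "signed_less tent (sdrop i s) (sdrop j s)" if "P i < P j" for i j
  proof -
    have "\<exists>k. s !! (i + k) \<noteq> s !! (j + k)"
      using ne[OF that] smap_alt[of id "sdrop i s" "sdrop j s"]
      by (auto simp: stream.map_id sdrop_snth)
    then show ?thesis using less that by blast
  qed
  have inj: "P i \<noteq> P j" if "i < n" "j < n" "i \<noteq> j" for i j
    using that dist len\<pi> by (simp add: P_def nth_eq_iff_index_eq)
  have "rotate p w \<noteq> w" if p: "0 < p" "p < n" for p
  proof
    assume "rotate p w = w"
    then have "sdrop p s = sdrop 0 s" using len p by (simp add: s_def sdrop_cycle)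
    moreover have "P p < P 0 \<or> P 0 < P p" using inj[of p 0] p by linarith
    ultimately show False using ne by metis
  qed
  then show "primitive_word w" using primitive_word_iff_rotate len by blast
  have "signed_less tent (sdrop i s) (sdrop j s) \<longleftrightarrow> P i < P j" if "i < n" "j < n" for i j
    using mono[of i j] mono[of j i] inj[OF that] signed_less_trans signed_less_irrefl
    by (metis linorder_neqE_nat)
  then have "is_pattern tent n s \<pi>"
    using assms(2) by (simp add: is_pattern_def P_def)
  then show "pattern tent n (cycle w) = \<pi>" unfolding s_def by (rule pattern_eqI)
qed

text \<open>The peak \<open>q\<close> is the cyclic predecessor of the position of rank
  \<open>n\<close>, the turning point of the unimodal map on ranks.\<close>

lemma ex_peak:
  assumes "n > 0" "\<pi> \<in> permutations_of_set {1..n}"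
  obtains q where "q < n" "\<And>i. i < n \<Longrightarrow> i \<noteq> q \<Longrightarrow> \<pi> ! (Suc i mod n) < \<pi> ! (Suc q mod n)"
proof -
  have len: "length \<pi> = n" and dist: "distinct \<pi>" and set: "set \<pi> = {1..n}"
    using assms(2) length_finite_permutations_of_set[OF assms(2)]
    by (auto dest: permutations_of_setD)
  obtain r where r: "r < n" "\<pi> ! r = n"
    using set assms(1) len by (metis atLeastAtMost_iff in_set_conv_nth le_refl less_eq_Suc_le One_nat_def)
  \<comment> \<open>Adding \<open>n\<close> before subtracting 1 handles the predecessor of position
    0.\<close>
  define q where "q = (r + n - 1) mod n"
  have q: "q < n" "Suc q mod n = r" using r assms(1) by (auto simp: q_def mod_Suc_eq)
  have "\<pi> ! (Suc i mod n) < \<pi> ! (Suc q mod n)" if i: "i < n" "i \<noteq> q" for i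
  proof -
    have "Suc i mod n \<noteq> Suc q mod n" using i q(1) by (auto simp: mod_Suc split: if_splits)
    moreover have "Suc i mod n < n" using assms(1) by simp
    ultimately have "\<pi> ! (Suc i mod n) \<noteq> n" "\<pi> ! (Suc i mod n) \<in> {1..n}"
      using q(2) r len dist set by (metis nth_eq_iff_index_eq, metis nth_mem)
    then show ?thesis using q(2) r(2) by simp
  qed
  then show ?thesis using that q(1) by blast
qed

section \<open>The single free letter of a compatible word\<close>

context
  fixes n q :: nat and \<pi> :: "nat list"
  assumes perm: "\<pi> \<in> permutations_of_set {1..n}"
    and q: "q < n"
    and peak: "\<And>i. i < n \<Longrightarrow> i \<noteq> q \<Longrightarrow> \<pi> ! (Suc i mod n) < \<pi> ! (Suc q mod n)"
begin

text \<open>A letter 1 at a rank below the peak would force a 1 at \<open>q\<close>, and a letter 0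
  above it would force a 0 at \<open>q\<close>. Either way monotonicity would place the successor of
  \<open>i\<close> above that of \<open>q\<close>, against the choice of the peak.\<close>

lemma compatible_letter:
  assumes "compatible n \<pi> w" "i < n" "i \<noteq> q"
  shows "w ! i = (if \<pi> ! i < \<pi> ! q then 0 else 1)"
proof -
  have len: "length \<pi> = n" and dist: "distinct \<pi>"
    using perm length_finite_permutations_of_set[OF perm] by (auto dest: permutations_of_setD)
  have two: "w ! i < 2" if "i < n" for i
    using compatible_letter_less assms(1) that .
  have "\<pi> ! i \<noteq> \<pi> ! q" using dist len assms q by (simp add: nth_eq_iff_index_eq)
  then consider "\<pi> ! i < \<pi> ! q" | "\<pi> ! q < \<pi> ! i" by linarith
  then show ?thesis
  proof cases
    case 1
    then have "w ! i \<le> w ! q"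
      "w ! i = w ! q \<Longrightarrow> w ! i \<noteq> 0 \<Longrightarrow> \<pi> ! (Suc q mod n) < \<pi> ! (Suc i mod n)"
      using assms q unfolding compatible_def by metis+
    then show ?thesis using 1 peak[OF assms(2,3)] two[OF q] two[OF assms(2)] by fastforce
  next
    case 2
    then have "w ! q \<le> w ! i"
      "w ! i = w ! q \<Longrightarrow> w ! i = 0 \<Longrightarrow> \<pi> ! (Suc q mod n) < \<pi> ! (Suc i mod n)"
      using assms q unfolding compatible_def by metis+
    then show ?thesis using 2 peak[OF assms(2,3)] two[OF q] two[OF assms(2)] by fastforce
  qed
qed

text \<open>Lower ranks carry 0 and higher ranks carry 1, so either letter at \<open>q\<close>
  respects the order of letters. When it equals the letter it is compared with, the required
  inequality is that the successor of \<open>q\<close> has the largest rank.\<close>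

lemma compatible_update_peak:
  assumes "compatible n \<pi> w" "x < 2"
  shows "compatible n \<pi> (w[q := x])"
proof -
  have len: "length w = n" and sub: "set w \<subseteq> {..<2}" using assms by (auto simp: compatible_def)
  have "w[q := x] ! i \<le> w[q := x] ! j \<and> (w[q := x] ! i = w[q := x] ! j \<longrightarrow>
        (if w[q := x] ! i = 0 then \<pi> ! (Suc i mod n) < \<pi> ! (Suc j mod n)
         else \<pi> ! (Suc j mod n) < \<pi> ! (Suc i mod n)))"
    if ij: "i < n" "j < n" "\<pi> ! i < \<pi> ! j" for i j
  proof -
    consider "i = q" "j \<noteq> q" | "j = q" "i \<noteq> q" | "i \<noteq> q" "j \<noteq> q" using ij by fastforce
    then show ?thesis
    proof cases
      case 1
      then have "w ! j = 1" using compatible_letter[OF assms(1) ij(2)] ij by simp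
      then show ?thesis using 1 peak[OF ij(2)] assms(2) q len by auto
    next
      case 2
      then have "w ! i = 0" using compatible_letter[OF assms(1) ij(1)] ij by simp
      then show ?thesis using 2 peak[OF ij(1)] assms(2) q len by auto
    next
      case 3
      then have "w[q := x] ! i = w ! i" "w[q := x] ! j = w ! j" by auto
      then show ?thesis using assms(1) ij unfolding compatible_def by auto
    qed
  qed
  moreover have "set (w[q := x]) \<subseteq> {..<2}"
    using sub assms(2) set_update_subset_insert[of w q x] by auto
  ultimately show ?thesis unfolding compatible_def using len by auto
qed

text \<open>Flipping the letter at \<open>q\<close> preserves compatibility and changes the parity
  of the weight.\<close>

lemma ex_compatible_odd:
  assumes "compatible n \<pi> w"
  shows "\<exists>w'. compatible n \<pi> w' \<and> odd (sum_list w')"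
proof -
  have len: "length w = n" and two: "w ! q < 2"
    using assms q compatible_letter_less[of n \<pi> w q] by (auto simp: compatible_def)
  have "sum_list w = sum_list (take q w) + (w ! q + sum_list (drop (Suc q) w))"
    by (metis id_take_nth_drop len q sum_list.append sum_list.Cons)
  moreover have "sum_list (w[q := 1 - w ! q]) =
      sum_list (take q w) + (1 - w ! q + sum_list (drop (Suc q) w))"
    using len q by (simp add: upd_conv_take_nth_drop)
  ultimately have "odd (sum_list w) \<or> odd (sum_list (w[q := 1 - w ! q]))"
    using two by (auto simp: less_2_cases_iff)
  then show ?thesis
    using assms compatible_update_peak[OF assms, of "1 - w ! q"] by fastforce
qed

text \<open>The permutation fixes every letter away from \<open>q\<close>, and the parity of the
  weight fixes the letter at \<open>q\<close>.\<close>

lemma compatible_odd_unique: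
  assumes "compatible n \<pi> w" "odd (sum_list w)" "compatible n \<pi> w'" "odd (sum_list w')"
  shows "w = w'"
proof -
  have len: "length w = n" "length w' = n" and two: "w ! q < 2" "w' ! q < 2"
    using assms q compatible_letter_less[of n \<pi> _ q] by (auto simp: compatible_def)
  have upd: "w' = w[q := w' ! q]"
  proof (rule nth_equalityI)
    fix i assume "i < length w'"
    then show "w' ! i = w[q := w' ! q] ! i"
      using compatible_letter[OF assms(1), of i] compatible_letter[OF assms(3), of i] len
      by (cases "i = q") auto
  qed (use len in simp)
  have "sum_list w = sum_list (take q w) + (w ! q + sum_list (drop (Suc q) w))"
    by (metis id_take_nth_drop len(1) q sum_list.append sum_list.Cons)
  moreover have "sum_list w' = sum_list (take q w) + (w' ! q + sum_list (drop (Suc q) w))"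
    using len q by (subst upd) (simp add: upd_conv_take_nth_drop)
  ultimately have "w ! q = w' ! q" using assms(2,4) two by (auto simp: less_2_cases_iff)
  then show ?thesis using upd by (metis list_update_id)
qed

end

section \<open>Patterns correspond to primitive words of odd weight\<close>

lemma bij_betw_pattern_odd_words:
  assumes "n > 0"
  shows "bij_betw (\<lambda>w. pattern tent n (cycle w)) {w \<in> odd_words n. primitive_word w}
    (periodic_patterns tent n)"
proof -
  let ?f = "\<lambda>w. pattern tent n (cycle w)" and ?O = "{w \<in> odd_words n. primitive_word w}"
  have len: "length tent = 2" by (simp add: tent_def)
  have mem: "?f w \<in> periodic_patterns tent n"
    if "length w = n" "set w \<subseteq> {..<2}" "primitive_word w" for w
    unfolding periodic_patterns_def periodic_words_def len using that by blast
  have perm: "\<pi> \<in> permutations_of_set {1..n}" if "\<pi> \<in> periodic_patterns tent n" for \<pi>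
    using that periodic_patterns_permutations by blast
  have comp: "compatible n (?f w) w" if "w \<in> ?O" for w
    using that compatible_pattern[OF assms] by (auto simp: odd_words_def)
  have "inj_on ?f ?O"
  proof (rule inj_onI)
    fix w w' assume w: "w \<in> ?O" and w': "w' \<in> ?O" and eq: "?f w = ?f w'"
    have p: "?f w \<in> permutations_of_set {1..n}" using w mem perm by (auto simp: odd_words_def)
    obtain q where q: "q < n"
      "\<And>i. i < n \<Longrightarrow> i \<noteq> q \<Longrightarrow> ?f w ! (Suc i mod n) < ?f w ! (Suc q mod n)"
      using ex_peak[OF assms p] by blast
    show "w = w'"
      using compatible_odd_unique[OF p q comp[OF w] _ comp[OF w', folded eq]] w w'
      by (auto simp: odd_words_def)
  qed
  moreover have "?f ` ?O = periodic_patterns tent n"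
  proof (intro equalityI subsetI)
    fix \<pi> assume \<pi>: "\<pi> \<in> periodic_patterns tent n"
    then obtain w where w: "\<pi> = ?f w" "length w = n" "set w \<subseteq> {..<2}" "primitive_word w"
      unfolding periodic_patterns_def periodic_words_def len by blast
    obtain q where q: "q < n"
      "\<And>i. i < n \<Longrightarrow> i \<noteq> q \<Longrightarrow> \<pi> ! (Suc i mod n) < \<pi> ! (Suc q mod n)"
      using ex_peak[OF assms perm[OF \<pi>]] by blast
    have "compatible n \<pi> w" using compatible_pattern[OF assms w(2-4)] w(1) by simp
    \<comment> \<open>The realizing word may have even weight. Its odd variant stays compatible with
      the pattern, hence is primitive and realizes the same pattern.\<close>
    then obtain w' where w': "compatible n \<pi> w'" "odd (sum_list w')"
      using ex_compatible_odd[OF perm[OF \<pi>] q] by blast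
    then have "w' \<in> ?O" "?f w' = \<pi>"
      using compatible_odd_imp[OF assms perm[OF \<pi>]] by (auto simp: odd_words_def compatible_def)
    then show "\<pi> \<in> ?f ` ?O" by blast
  qed (use mem in \<open>auto simp: odd_words_def\<close>)
  ultimately show ?thesis by (simp add: bij_betw_def)
qed

theorem theorem3p4:
  fixes n :: nat
  assumes "n \<ge> 1"
  shows "real (num_pattern_classes tent n) =
    1 / (2 * real n) * (\<Sum>d | d dvd n \<and> odd d. of_int (moebius_mu d) * 2 ^ (n div d))"
proof -
  have n: "n > 0" using assms by simp
  have "2 * int (card (periodic_patterns tent n)) =
      (\<Sum>d | d dvd n \<and> odd d. moebius_mu d * 2 ^ (n div d))"
    using card_primitive_odd_words[OF n] bij_betw_same_card[OF bij_betw_pattern_odd_words[OF n]]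
    by simp
  then have "real_of_int (2 * int (card (periodic_patterns tent n))) =
      real_of_int (\<Sum>d | d dvd n \<and> odd d. moebius_mu d * 2 ^ (n div d))"
    by (rule arg_cong)
  then have "2 * real (card (periodic_patterns tent n)) =
      (\<Sum>d | d dvd n \<and> odd d. of_int (moebius_mu d) * 2 ^ (n div d))"
    by simp
  then show ?thesis using n by (simp add: num_pattern_classes_eq field_simps)
qed

end
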